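(* The pair $(J^2(L),J^2_S(L))$ forms a strictly stronger invariant than the naïve writhe $N(L)$ on the set of $2$-colourable oriented virtual links. That is: (a) if $L$ is a $2$-colourable oriented virtual link such that $(J^2(L),J^2_S(L))$ is trivial (all entries of $J^2(L)$ are $0$ and $J^2_S(L)=0$), then $N(L)=0$; and (b) there exists a $2$-colourable oriented virtual link $L$ such that $(J^2(L),J^2_S(L))$ is not trivial but $N(L)=0$.
   Context: A virtual link diagram is a generic immersion of finitely many circles in the plane whose double points are marked either as classical crossings (with over/under information) or virtual crossings. A virtual link is an equivalence class of such diagrams under the virtual Reidemeister moves; $|L|$ denotes its number of components. Classical crossings of an oriented diagram have a sign $\pm1$ in the usual way. A self-crossing is a classical crossing of a component with itself; a mixed crossing is a classical crossing between two distinct components. Shadow: $S(D)$ is obtained from $D$ by forgetting the over/under decoration at classical crossings, which become flat crossings. The arcs of $S(D)$ run between flat crossings (passing straight through virtual crossings); a component without classical crossings is a single arc. A $2$-colouring $\mathscr{C}$ of $D$ is a colouring of the arcs of $S(D)$, each exactly one of red and green, such that on each of the two strands through a flat crossing the colour changes when passing straight through the crossing (so the four arc-ends are cyclically red, red, green, green). The global dual $\overline{\mathscr{C}}$ is obtained by interchanging red and green throughout. A diagram or link is $2$-colourable if it has a $2$-colouring (this is independent of the diagram). $2$-colour parity: for an oriented $D$ with $2$-colouring $\mathscr{C}$, a classical crossing $c$ has $\mathfrak{p}_{\mathscr{C}}(c)=0$ (even) if the two arcs oriented into $c$ have different colours, and $\mathfrak{p}_{\mathscr{C}}(c)=1$ (odd)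 if they have the same colour. A generating set of $2$-colourings of a diagram $D$ of $L$ is a set $\{\mathscr{C}_1,\ldots,\mathscr{C}_{2^{|L|-1}}\}$ consisting of one $2$-colouring from each pair $\{\mathscr{C},\overline{\mathscr{C}}\}$. Put $J_{\mathscr{C}}(D)=\sum_{\mathfrak{p}_{\mathscr{C}}(c)=1}\mathrm{sign}(c)$. The $2$-colour writhe is $J^2(L)=J^2(D)=(J_{\mathscr{C}_1}(D),\ldots,J_{\mathscr{C}_{2^{|L|-1}}}(D))\in\mathbb{Z}^{2^{|L|-1}}$, considered up to permutation of the entries; it does not depend on the generating set or on the diagram. $J^2_S(L)=J^2_S(D)$ is the sum of $\mathrm{sign}(c)$ over the self-crossings $c$ of $D$ with $\mathfrak{p}_{\mathscr{C}}(c)=1$; it is independent of the $2$-colouring $\mathscr{C}$ and of the diagram. Naïve writhe: $N(L)=N(D)$ is the sum of $\mathrm{sign}(c)$ over all mixed crossings $c$ of a diagram $D$ of $L$. *)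

theory Defs
  imports "HOL-Analysis.Analysis" "HOL-Library.Multiset" "HOL-Library.FuncSet"
begin

(* Virtual link diagrams: the plane is the complex plane, every circle is the unit circle
   with its counterclockwise orientation, so all diagrams are oriented. A point of the
   underlying disjoint union of circles is a pair of a component index and a point of the
   unit circle. *)

type_synonym point = "nat \<times> complex"

(* classical is the set of double points marked as classical; all other double points are
   virtual. For a classical crossing z, over z is the preimage of z on the over-strand. *)
record vdiagram =
  ncomp :: nat
  curve :: "nat \<Rightarrow> complex \<Rightarrow> complex"
  classical :: "complex set"
  over :: "complex \<Rightarrow> point"

abbreviation circle :: "complex set" where
  "circle \<equiv> sphere 0 1"

definition points :: "vdiagram \<Rightarrow> point set" where
  "points D = {..<ncomp D} \<times> circle"

definition pos :: "vdiagram \<Rightarrow> point \<Rightarrow> complex" where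
  "pos D p = curve D (fst p) (snd p)"

definition fibre :: "vdiagram \<Rightarrow> complex \<Rightarrow> point set" where
  "fibre D z = {p \<in> points D. pos D p = z}"

definition crossings :: "vdiagram \<Rightarrow> complex set" where
  "crossings D = {z. \<exists>p q. p \<in> fibre D z \<and> q \<in> fibre D z \<and> p \<noteq> q}"

definition tangent :: "vdiagram \<Rightarrow> point \<Rightarrow> complex" where
  "tangent D p = vector_derivative (\<lambda>t. curve D (fst p) (snd p * cis t)) (at 0)"

definition smooth :: "(real \<Rightarrow> complex) \<Rightarrow> bool" where
  "smooth f \<longleftrightarrow> (\<exists>g :: nat \<Rightarrow> real \<Rightarrow> complex.
      g 0 = f \<and> (\<forall>k t. (g k has_vector_derivative g (Suc k) t) (at t)))"

(* The determinant of the pair of plane vectors (u, v). *)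
definition cross :: "complex \<Rightarrow> complex \<Rightarrow> real" where
  "cross u v = Im (cnj u * v)"

(* Generic immersion: smooth immersion whose multiple points are finitely many transverse
   double points. *)
definition vlink_diagram :: "vdiagram \<Rightarrow> bool" where
  "vlink_diagram D \<longleftrightarrow>
     0 < ncomp D \<and>
     (\<forall>i<ncomp D. smooth (\<lambda>t. curve D i (cis t))) \<and>
     (\<forall>p\<in>points D. tangent D p \<noteq> 0) \<and>
     finite (crossings D) \<and>
     (\<forall>z\<in>crossings D. card (fibre D z) = 2) \<and>
     (\<forall>z\<in>crossings D. \<forall>p\<in>fibre D z. \<forall>q\<in>fibre D z.
        p \<noteq> q \<longrightarrow> cross (tangent D p) (tangent D q) \<noteq> 0) \<and>
     classical D \<subseteq> crossings D \<and>
     (\<forall>z\<in>classical D. over D z \<in> fibre D z)"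

definition under :: "vdiagram \<Rightarrow> complex \<Rightarrow> point" where
  "under D z = (THE q. q \<in> fibre D z \<and> q \<noteq> over D z)"

definition crossing_sign :: "vdiagram \<Rightarrow> complex \<Rightarrow> int" where
  "crossing_sign D z =
     (if cross (tangent D (over D z)) (tangent D (under D z)) > 0 then 1 else - 1)"

definition self_crossings :: "vdiagram \<Rightarrow> complex set" where
  "self_crossings D = {z \<in> classical D. fst (over D z) = fst (under D z)}"

definition mixed_crossings :: "vdiagram \<Rightarrow> complex set" where
  "mixed_crossings D = {z \<in> classical D. fst (over D z) \<noteq> fst (under D z)}"

definition naive_writhe :: "vdiagram \<Rightarrow> int" where
  "naive_writhe D = (\<Sum>z\<in>mixed_crossings D. crossing_sign D z)"

(* The connected components of a subset P of the disjoint union of the circles. *)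
definition pieces :: "vdiagram \<Rightarrow> point set \<Rightarrow> point set set" where
  "pieces D P =
     (\<Union>i<ncomp D. (\<lambda>A. {i} \<times> A) ` components {w \<in> circle. (i, w) \<in> P})"

(* Virtual links: planar isotopy and virtual Reidemeister moves *)

(* D' is the image of D under the end of an ambient isotopy H of the plane, up to
   orientation preserving reparametrisation of the circles (theta is a lift to the real
   line) and renumbering of the components (sigma). *)
definition plane_isotopic :: "vdiagram \<Rightarrow> vdiagram \<Rightarrow> bool" where
  "plane_isotopic D D' \<longleftrightarrow>
     (\<exists>(H :: real \<Rightarrow> complex \<Rightarrow> complex) \<sigma> (\<theta> :: nat \<Rightarrow> real \<Rightarrow> real).
        continuous_on ({0..1} \<times> UNIV) (\<lambda>(s, z). H s z) \<and>
        (\<forall>z. H 0 z = z) \<and>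
        (\<forall>s\<in>{0..1}. \<exists>K. homeomorphism UNIV UNIV (H s) K) \<and>
        ncomp D' = ncomp D \<and>
        bij_betw \<sigma> {..<ncomp D} {..<ncomp D} \<and>
        (\<forall>i<ncomp D. continuous_on UNIV (\<theta> i) \<and> strict_mono (\<theta> i) \<and>
           (\<forall>t. \<theta> i (t + 2 * pi) = \<theta> i t + 2 * pi)) \<and>
        (\<forall>i<ncomp D. \<forall>t. curve D' (\<sigma> i) (cis (\<theta> i t)) = H 1 (curve D i (cis t))) \<and>
        classical D' = H 1 ` classical D \<and>
        (\<forall>z\<in>classical D. \<forall>i<ncomp D. \<forall>t. over D z = (i, cis t) \<longrightarrow>
           over D' (H 1 z) = (\<sigma> i, cis (\<theta> i t))))"

(* The part of D in the open disc of centre c and radius r is a tangle without closed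
   components, properly embedded at the boundary up to the crossings inside. *)
definition tangle_disc :: "complex \<Rightarrow> real \<Rightarrow> vdiagram \<Rightarrow> bool" where
  "tangle_disc c r D \<longleftrightarrow>
     crossings D \<inter> sphere c r = {} \<and>
     (\<forall>p\<in>points D. pos D p \<in> sphere c r \<longrightarrow> (pos D p - c) \<bullet> tangent D p \<noteq> 0) \<and>
     (\<forall>i<ncomp D. \<exists>w\<in>circle. curve D i w \<notin> ball c r)"

(* D and D' coincide, decorations included, outside the disc. *)
definition agree_outside :: "complex \<Rightarrow> real \<Rightarrow> vdiagram \<Rightarrow> vdiagram \<Rightarrow> bool" where
  "agree_outside c r D D' \<longleftrightarrow>
     0 < r \<and> tangle_disc c r D \<and> tangle_disc c r D' \<and>
     ncomp D' = ncomp D \<and>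
     (\<forall>p\<in>points D. pos D' p \<in> ball c r \<longleftrightarrow> pos D p \<in> ball c r) \<and>
     (\<forall>p\<in>points D. pos D p \<notin> ball c r \<longrightarrow> pos D' p = pos D p) \<and>
     classical D' - ball c r = classical D - ball c r \<and>
     (\<forall>z\<in>classical D - ball c r. over D' z = over D z)"

(* The arcs in which the diagram traverses the disc, as sets of points of the circles.
   Diagrams that agree outside the disc have the same strands. *)
definition strands :: "complex \<Rightarrow> real \<Rightarrow> vdiagram \<Rightarrow> point set set" where
  "strands c r D = pieces D {p. pos D p \<in> ball c r}"

definition joins :: "vdiagram \<Rightarrow> complex \<Rightarrow> point set \<Rightarrow> point set \<Rightarrow> bool" where
  "joins D z s t \<longleftrightarrow> (\<exists>p\<in>s. \<exists>q\<in>t. p \<noteq> q \<and> pos D p = z \<and> pos D q = z)"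

(* In each move the two tangles are described by the crossings of their strands; this
   determines them up to isotopy of the disc relative to its boundary. *)

(* First moves: a single strand acquires one crossing, classical of either kind or
   virtual. *)
definition move1 :: "vdiagram \<Rightarrow> vdiagram \<Rightarrow> bool" where
  "move1 D D' \<longleftrightarrow> (\<exists>c r. agree_outside c r D D' \<and>
     card (strands c r D) = 1 \<and>
     crossings D \<inter> ball c r = {} \<and>
     card (crossings D' \<inter> ball c r) = 1)"

(* Second moves: two strands acquire a bigon, whose crossings are both virtual, or both
   classical with the same strand over. *)
definition move2 :: "vdiagram \<Rightarrow> vdiagram \<Rightarrow> bool" where
  "move2 D D' \<longleftrightarrow> (\<exists>c r s t. agree_outside c r D D' \<and>
     strands c r D = {s, t} \<and> s \<noteq> t \<and>
     crossings D \<inter> ball c r = {} \<and>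
     card (crossings D' \<inter> ball c r) = 2 \<and>
     (\<forall>z\<in>crossings D' \<inter> ball c r. joins D' z s t) \<and>
     (crossings D' \<inter> ball c r \<inter> classical D' = {} \<or>
      crossings D' \<inter> ball c r \<subseteq> classical D' \<and>
      over D' ` (crossings D' \<inter> ball c r) \<subseteq> s))"

definition triangle ::
  "complex \<Rightarrow> real \<Rightarrow> point set \<Rightarrow> point set \<Rightarrow> point set \<Rightarrow> vdiagram \<Rightarrow>
   complex \<Rightarrow> complex \<Rightarrow> complex \<Rightarrow> bool" where
  "triangle c r s t u D x y z \<longleftrightarrow>
     crossings D \<inter> ball c r = {x, y, z} \<and> card {x, y, z} = 3 \<and>
     joins D x s t \<and> joins D y s u \<and> joins D z t u"

(* The decorations admitted in the third moves: all crossings classical with s on top, t in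
   the middle and u at the bottom; all virtual; or the mixed move, in which u crosses s and
   t virtually and s passes over t. *)
definition marks_classical where
  "marks_classical s t D x y z \<longleftrightarrow>
     {x, y, z} \<subseteq> classical D \<and>
     over D x \<in> s \<and> over D y \<in> s \<and> over D z \<in> (t :: point set)"

definition marks_virtual where
  "marks_virtual D x y z \<longleftrightarrow> {x, y, z} \<inter> classical D = {}"

definition marks_mixed where
  "marks_mixed s D x y z \<longleftrightarrow>
     x \<in> classical D \<and> over D x \<in> (s :: point set) \<and> {y, z} \<inter> classical D = {}"

(* Third moves: up to isotopy there are exactly two arrangements of three strands that
   cross pairwise once, exchanged by the move. *)
definition move3 :: "vdiagram \<Rightarrow> vdiagram \<Rightarrow> bool" where
  "move3 D D' \<longleftrightarrow> (\<exists>c r s t u x y z x' y' z'. agree_outside c r D D' \<and>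
     strands c r D = {s, t, u} \<and> card {s, t, u} = 3 \<and>
     triangle c r s t u D x y z \<and> triangle c r s t u D' x' y' z' \<and>
     (marks_classical s t D x y z \<and> marks_classical s t D' x' y' z' \<or>
      marks_virtual D x y z \<and> marks_virtual D' x' y' z' \<or>
      marks_mixed s D x y z \<and> marks_mixed s D' x' y' z'))"

definition vmove :: "vdiagram \<Rightarrow> vdiagram \<Rightarrow> bool" where
  "vmove D D' \<longleftrightarrow> vlink_diagram D \<and> vlink_diagram D' \<and>
     (plane_isotopic D D' \<or> move1 D D' \<or> move2 D D' \<or> move3 D D')"

definition virtual_links :: "vdiagram set set" where
  "virtual_links =
     {D. vlink_diagram D} //
     {(D, D'). vlink_diagram D \<and> vlink_diagram D' \<and> equivclp vmove D D'}"

(* 2-colourings *)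

(* The arcs of the shadow: virtual crossings do not cut the circles. *)
definition arcs :: "vdiagram \<Rightarrow> point set set" where
  "arcs D = pieces D {p. pos D p \<notin> classical D}"

definition arc_in :: "vdiagram \<Rightarrow> point \<Rightarrow> point set" where
  "arc_in D p =
     (THE a. a \<in> arcs D \<and> (\<forall>\<^sub>F t in at_left 0. (fst p, snd p * cis t) \<in> a))"

definition arc_out :: "vdiagram \<Rightarrow> point \<Rightarrow> point set" where
  "arc_out D p =
     (THE a. a \<in> arcs D \<and> (\<forall>\<^sub>F t in at_right 0. (fst p, snd p * cis t) \<in> a))"

datatype colour = Red | Green

fun opposite :: "colour \<Rightarrow> colour" where
  "opposite Red = Green"
| "opposite Green = Red"

type_synonym colouring = "point set \<Rightarrow> colour"

definition two_colourings :: "vdiagram \<Rightarrow> colouring set" where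
  "two_colourings D =
     {C \<in> arcs D \<rightarrow>\<^sub>E UNIV. \<forall>z\<in>classical D. \<forall>p\<in>fibre D z. C (arc_in D p) \<noteq> C (arc_out D p)}"

definition two_colourable :: "vdiagram \<Rightarrow> bool" where
  "two_colourable D \<longleftrightarrow> two_colourings D \<noteq> {}"

definition dual :: "vdiagram \<Rightarrow> colouring \<Rightarrow> colouring" where
  "dual D C = restrict (\<lambda>a. opposite (C a)) (arcs D)"

definition parity :: "vdiagram \<Rightarrow> colouring \<Rightarrow> complex \<Rightarrow> nat" where
  "parity D C z =
     (if C (arc_in D (over D z)) \<noteq> C (arc_in D (under D z)) then 0 else 1)"

definition J :: "vdiagram \<Rightarrow> colouring \<Rightarrow> int" where
  "J D C = (\<Sum>z\<in>{z \<in> classical D. parity D C z = 1}. crossing_sign D z)"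

definition generating_set :: "vdiagram \<Rightarrow> colouring set \<Rightarrow> bool" where
  "generating_set D G \<longleftrightarrow>
     G \<subseteq> two_colourings D \<and> (\<forall>C\<in>two_colourings D. card (G \<inter> {C, dual D C}) = 1)"

(* The 2-colour writhe as an unordered tuple, i.e. the multiset of its entries. It does not
   depend on the generating set chosen, since dual colourings have the same parities. *)
definition J2 :: "vdiagram \<Rightarrow> int multiset" where
  "J2 D = image_mset (J D) (mset_set (SOME G. generating_set D G))"

(* The value does not depend on the 2-colouring chosen. *)
definition J2S :: "vdiagram \<Rightarrow> int" where
  "J2S D = (let C = (SOME C. C \<in> two_colourings D)
            in \<Sum>z\<in>{z \<in> self_crossings D. parity D C z = 1}. crossing_sign D z)"

definition trivial_pair :: "int multiset \<times> int \<Rightarrow> bool" where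
  "trivial_pair P \<longleftrightarrow> (\<forall>x\<in>#fst P. x = 0) \<and> snd P = 0"

end

theory Submission
  imports Defs
begin

text \<open>Reversing the colours on a set \<open>I\<close> of components of a 2-coloured diagram gives another
  2-colouring. It keeps the parities of the self-crossings, and it changes the parity of a mixed
  crossing iff exactly one of its two components lies in \<open>I\<close>, which happens for half of all \<open>I\<close>.
  The average of \<open>J\<close> over all \<open>I\<close> is therefore \<open>J\<^sup>2\<^sub>S + N / 2\<close>, whence (a). For (b), take a chain of
  three round circles with all four crossings classical, the first two circles meeting in
  positive and the last two in negative crossings: there is a colouring for which exactly the
  negative crossings are odd.\<close>

section \<open>Arcs\<close>

text \<open>Every component contains a nonempty member of the cover, and components are disjoint, so
  picking such a member is injective. The cover need not consist of disjoint or maximal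
  sets.\<close>

lemma finite_components_if_finite_cover:
  assumes "finite \<U>" "\<And>U. U \<in> \<U> \<Longrightarrow> connected U" "\<Union>\<U> = X"
  shows "finite (components X)"
proof -
  have "\<exists>U\<in>\<U>. U \<noteq> {} \<and> U \<subseteq> A" if A: "A \<in> components X" for A
  proof -
    obtain x where x: "x \<in> A" using in_components_nonempty[OF A] by blast
    then obtain U where U: "U \<in> \<U>" "x \<in> U"
      using in_components_subset[OF A] assms(3) by blast
    have "U \<subseteq> A"
      using components_maximal[OF A assms(2)[OF U(1)]] U x assms(3) by blast
    then show ?thesis using U by blast
  qed
  then obtain f where f: "\<And>A. A \<in> components X \<Longrightarrow> f A \<in> \<U> \<and> f A \<noteq> {} \<and> f A \<subseteq> A"
    by metis
  have "inj_on f (components X)"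
  proof (rule inj_onI)
    fix A B assume AB: "A \<in> components X" "B \<in> components X" "f A = f B"
    then have "A \<inter> B \<noteq> {}" using f[OF AB(1)] f[OF AB(2)] by auto
    then show "A = B" using components_nonoverlap[OF AB(1,2)] by blast
  qed
  moreover have "finite (f ` components X)"
    using f assms(1) by (meson finite_subset image_subsetI)
  ultimately show ?thesis using finite_imageD by blast
qed

text \<open>By induction on \<open>T\<close>: removing \<open>x\<close> cuts each piece into its
  parts left and right of \<open>x\<close>. Some parts may be empty, but they are still
  connected.\<close>

lemma interval_diff_finite_cover:
  fixes a b :: real
  assumes "finite T"
  shows "\<exists>\<U>. finite \<U> \<and> (\<forall>U\<in>\<U>. connected U) \<and> \<Union>\<U> = {a..b} - T"
  using assms
proof (induction T)
  case empty
  show ?case by (intro exI[of _ "{{a..b}}"]) auto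
next
  case (insert x T)
  then obtain \<U> where \<U>: "finite \<U>" "\<forall>U\<in>\<U>. connected U" "\<Union>\<U> = {a..b} - T" by blast
  have "connected (U \<inter> {..<x})" "connected (U \<inter> {x<..})" if "U \<in> \<U>" for U
    using \<U>(2) that by (auto simp: is_interval_connected_1[symmetric] intro!: is_interval_Int)
  moreover have "\<Union>((\<lambda>U. U \<inter> {..<x}) ` \<U> \<union> (\<lambda>U. U \<inter> {x<..}) ` \<U>) = {a..b} - insert x T"
    using \<U>(3) by (force simp: not_less_iff_gr_or_eq)
  ultimately show ?case
    using \<U>(1) by (intro exI[of _ "(\<lambda>U. U \<inter> {..<x}) ` \<U> \<union> (\<lambda>U. U \<inter> {x<..}) ` \<U>"]) auto
qed

lemma finite_cis_preimage:
  assumes "finite F"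
  shows "finite {t \<in> {0..2 * pi}. cis t \<in> F}"
proof -
  have "finite (cis -` F \<inter> {0..<2 * pi})"
  proof (rule finite_vimage_IntI[OF assms])
    have "Arg2pi (cis t) = t" if "t \<in> {0..<2 * pi}" for t
      using Arg2pi_unique[of 1 t "cis t"] that by (simp add: cis_conv_exp)
    then show "inj_on cis {0..<2 * pi}" by (rule inj_on_inverseI)
  qed
  \<comment> \<open>\<open>cis\<close> is injective only on the half-open interval, so the right
    endpoint is added by hand.\<close>
  moreover have "{t \<in> {0..2 * pi}. cis t \<in> F} \<subseteq> insert (2 * pi) (cis -` F \<inter> {0..<2 * pi})"
    by auto
  ultimately show ?thesis by (meson finite_insert finite_subset)
qed

text \<open>The pieces of \<open>[0, 2 pi]\<close> left after removing the parameters of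
  \<open>F\<close> map under \<open>cis\<close> to a finite connected cover. The first and last
  piece may belong to one component, which a mere cover allows.\<close>

lemma finite_components_circle_diff:
  assumes "finite F"
  shows "finite (components (circle - F))"
proof -
  define T where "T = {t \<in> {0..2 * pi}. cis t \<in> F}"
  have "finite T" unfolding T_def by (rule finite_cis_preimage[OF assms])
  from interval_diff_finite_cover[OF this, of 0 "2 * pi"]
  obtain \<U> where \<U>: "finite \<U>" "\<forall>U\<in>\<U>. connected U" "\<Union>\<U> = {0..2 * pi} - T"
    by (elim exE conjE)
  have "circle - F \<subseteq> cis ` ({0..2 * pi} - T)"
  proof
    fix w :: complex assume w: "w \<in> circle - F"
    have "cis (Arg2pi w) = w"
      using Arg2pi_eq[of w, symmetric] w by (simp add: cis_conv_exp)
    moreover have "Arg2pi w \<in> {0..2 * pi}"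
      using Arg2pi_ge_0[of w] Arg2pi_lt_2pi[of w] by simp
    ultimately show "w \<in> cis ` ({0..2 * pi} - T)"
      using w by (intro image_eqI[of _ cis "Arg2pi w"]) (simp_all add: T_def)
  qed
  moreover have "cis ` ({0..2 * pi} - T) \<subseteq> circle - F"
    by (auto simp: T_def)
  ultimately have "\<Union>((`) cis ` \<U>) = circle - F"
    unfolding image_Union[symmetric] \<U>(3) by (rule subset_antisym[rotated])
  moreover have "connected V" if "V \<in> (`) cis ` \<U>" for V
  proof -
    from that obtain U where U: "V = cis ` U" "U \<in> \<U>" by blast
    have "continuous_on U cis" by (intro continuous_intros)
    then show ?thesis using connected_continuous_image U \<U>(2) by blast
  qed
  ultimately show ?thesis
    using finite_components_if_finite_cover[of "(`) cis ` \<U>"] \<U>(1) by blast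
qed

text \<open>Points of \<open>F\<close> other than \<open>w\<close> are avoided by continuity;
  \<open>w\<close> itself is avoided because \<open>cis t = 1\<close> only at multiples of
  \<open>2 * pi\<close>.\<close>

lemma eventually_cis_notin_finite:
  assumes "finite F" "w \<in> circle"
  shows "\<forall>\<^sub>F t in at 0. w * cis t \<notin> F"
proof -
  have "\<forall>\<^sub>F t in at 0. w * cis t \<noteq> x" if "x \<in> F" for x
  proof (cases "x = w")
    case True
    have "w * cis t \<noteq> w" if "t \<noteq> 0" "dist t 0 < 2 * pi" for t
    proof
      assume "w * cis t = w"
      then have "cis t = 1" using assms(2) by auto
      then have "cos t = 1" by (simp add: complex_eq_iff)
      then obtain n :: int where "t = of_int n * (2 * pi)"
        by (auto simp: cos_one_2pi_int)
      moreover have "n \<noteq> 0" using calculation that by auto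
      then have "1 \<le> \<bar>real_of_int n\<bar>" by linarith
      ultimately have "2 * pi \<le> \<bar>t\<bar>"
        using mult_right_mono[of 1 "\<bar>real_of_int n\<bar>" "2 * pi"] by (simp add: abs_mult)
      then show False using that by (simp add: dist_real_def)
    qed
    then show ?thesis
      unfolding eventually_at True by (intro exI[of _ "2 * pi"]) auto
  next
    case False
    have "((\<lambda>t. w * cis t) \<longlongrightarrow> w * cis 0) (at 0)"
      by (intro tendsto_intros)
    then show ?thesis using tendsto_imp_eventually_ne[of "\<lambda>t. w * cis t" w] False by auto
  qed
  then have "\<forall>\<^sub>F t in at 0. \<forall>x\<in>F. w * cis t \<noteq> x"
    using assms(1) by (intro eventually_ball_finite) auto
  then show ?thesis by (rule eventually_mono) auto
qed

text \<open>The points at which the \<open>i\<close>-th circle is cut into arcs.\<close>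

definition marked :: "vdiagram \<Rightarrow> nat \<Rightarrow> complex set" where
  "marked D i = {w \<in> circle. curve D i w \<in> classical D}"

lemma arcs_eq: "arcs D = (\<Union>i<ncomp D. (\<lambda>A. {i} \<times> A) ` components (circle - marked D i))"
proof -
  have "{w \<in> circle. (i, w) \<in> {p. pos D p \<notin> classical D}} = circle - marked D i" for i
    by (auto simp: marked_def pos_def)
  then show ?thesis unfolding arcs_def pieces_def by simp
qed

lemma fst_image_arc:
  assumes "a \<in> arcs D" "p \<in> a"
  shows "fst ` a = {fst p}"
  using assms by (force simp: arcs_eq)

lemma arc_connected:
  assumes "a \<in> arcs D"
  obtains i A where "i < ncomp D" "a = {i} \<times> A" "connected A" "A \<noteq> {}" "A \<subseteq> circle - marked D i"
  using assms unfolding arcs_eq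
  by (auto dest: in_components_connected in_components_nonempty in_components_subset)

lemma arcs_disjoint:
  assumes "a \<in> arcs D" "b \<in> arcs D" "p \<in> a" "p \<in> b"
  shows "a = b"
proof -
  obtain i A where A: "i < ncomp D" "a = {i} \<times> A" "A \<in> components (circle - marked D i)"
    using assms(1) by (auto simp: arcs_eq)
  obtain j B where B: "j < ncomp D" "b = {j} \<times> B" "B \<in> components (circle - marked D j)"
    using assms(2) by (auto simp: arcs_eq)
  have "i = j" "A \<inter> B \<noteq> {}" using A B assms(3,4) by auto
  then show ?thesis using A B components_nonoverlap by metis
qed

section \<open>Crossings of a diagram and the arcs at a point\<close>

locale diagram =
  fixes D :: vdiagram
  assumes diagram: "vlink_diagram D"
begin

lemma classical_subset: "classical D \<subseteq> crossings D"
  using diagram by (simp add: vlink_diagram_def)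

lemma finite_classical: "finite (classical D)"
  by (rule finite_subset[OF classical_subset]) (use diagram in \<open>simp add: vlink_diagram_def\<close>)

lemma card_fibre: "z \<in> classical D \<Longrightarrow> card (fibre D z) = 2"
  using classical_subset diagram by (auto simp: vlink_diagram_def)

lemma over_in_fibre: "z \<in> classical D \<Longrightarrow> over D z \<in> fibre D z"
  using diagram by (simp add: vlink_diagram_def)

lemma under_in_fibre:
  assumes "z \<in> classical D"
  shows "under D z \<in> fibre D z \<and> under D z \<noteq> over D z"
proof -
  obtain p q where "fibre D z = {p, q}" "p \<noteq> q"
    using card_fibre[OF assms] by (meson card_2_iff)
  then have "\<exists>!r. r \<in> fibre D z \<and> r \<noteq> over D z" using over_in_fibre[OF assms] by auto
  then show ?thesis unfolding under_def by (rule theI')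
qed

lemma finite_marked:
  assumes "i < ncomp D"
  shows "finite (marked D i)"
proof (rule finite_subset)
  show "marked D i \<subseteq> (\<Union>z\<in>classical D. snd ` fibre D z)"
    using assms by (force simp: marked_def fibre_def points_def pos_def)
  have "finite (fibre D z)" if "z \<in> classical D" for z
    using card_fibre[OF that] card.infinite by fastforce
  then show "finite (\<Union>z\<in>classical D. snd ` fibre D z)"
    using finite_classical by blast
qed

lemma finite_arcs: "finite (arcs D)"
  unfolding arcs_eq using finite_components_circle_diff finite_marked by auto

text \<open>This gives meaning to the descriptions in \<open>arc_in\<close> and
  \<open>arc_out\<close>. A short one-sided parameter interval avoids the marked points, so its
  connected image lies in a single arc; two arcs with this property share a point and hence
  coincide.\<close>

lemma ex1_arc:
  assumes "p \<in> points D" "F = at_left 0 \<or> F = at_right 0"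
  shows "\<exists>!a. a \<in> arcs D \<and> (\<forall>\<^sub>F t in F. (fst p, snd p * cis t) \<in> a)"
proof (rule ex_ex1I)
  define i w where "i = fst p" and "w = snd p"
  have i: "i < ncomp D" and w: "w \<in> circle" using assms(1) by (auto simp: points_def i_def w_def)
  obtain e where e: "e > 0" "\<And>t. t \<noteq> 0 \<Longrightarrow> \<bar>t\<bar> < e \<Longrightarrow> w * cis t \<notin> marked D i"
    using eventually_cis_notin_finite[OF finite_marked[OF i] w]
    unfolding eventually_at by (auto simp: dist_real_def)
  define T where "T = (if F = at_left 0 then {-e<..<0} else {0<..<e})"
  have T: "connected T" "T \<noteq> {}" "\<And>t. t \<in> T \<Longrightarrow> t \<noteq> 0 \<and> \<bar>t\<bar> < e"
    using e(1) by (auto simp: T_def split: if_splits)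
  have ev: "\<forall>\<^sub>F t in F. t \<in> T"
  proof (cases "F = at_left 0")
    case True
    then show ?thesis using eventually_at_leftI[of "-e" 0 "\<lambda>t. t \<in> T"] e(1) by (simp add: T_def)
  next
    case False
    then show ?thesis
      using eventually_at_rightI[of 0 e "\<lambda>t. t \<in> T"] e(1) assms(2) by (simp add: T_def)
  qed
  have "connected ((\<lambda>t. w * cis t) ` T)"
    using T(1) by (intro connected_continuous_image continuous_intros)
  moreover have "(\<lambda>t. w * cis t) ` T \<subseteq> circle - marked D i"
    using w e(2) T(3) by (auto simp: norm_mult)
  moreover have "circle - marked D i \<noteq> {}" using calculation T(2) by blast
  ultimately obtain A where A: "A \<in> components (circle - marked D i)" "(\<lambda>t. w * cis t) ` T \<subseteq> A"
    using exists_component_superset[of "(\<lambda>t. w * cis t) ` T"] by blast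
  have "\<forall>\<^sub>F t in F. (i, w * cis t) \<in> {i} \<times> A"
    using ev by (rule eventually_mono) (use A(2) in auto)
  moreover have "{i} \<times> A \<in> arcs D" using A(1) i unfolding arcs_eq by blast
  ultimately show "\<exists>a. a \<in> arcs D \<and> (\<forall>\<^sub>F t in F. (fst p, snd p * cis t) \<in> a)"
    unfolding i_def w_def by (intro exI conjI)
next
  fix a b
  assume "a \<in> arcs D \<and> (\<forall>\<^sub>F t in F. (fst p, snd p * cis t) \<in> a)"
    and "b \<in> arcs D \<and> (\<forall>\<^sub>F t in F. (fst p, snd p * cis t) \<in> b)"
  then have ab: "a \<in> arcs D" "b \<in> arcs D"
    and "\<forall>\<^sub>F t in F. (fst p, snd p * cis t) \<in> a \<and> (fst p, snd p * cis t) \<in> b"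
    by (auto intro: eventually_conj)
  moreover have "F \<noteq> bot" using assms(2) by (elim disjE) simp_all
  ultimately obtain t where "(fst p, snd p * cis t) \<in> a" "(fst p, snd p * cis t) \<in> b"
    using eventually_happens' by blast
  then show "a = b" using arcs_disjoint ab by blast
qed

lemma arc_in:
  assumes "p \<in> points D"
  shows "arc_in D p \<in> arcs D" "\<forall>\<^sub>F t in at_left 0. (fst p, snd p * cis t) \<in> arc_in D p"
  using theI'[OF ex1_arc[OF assms, of "at_left 0"]] by (auto simp: arc_in_def)

lemma arc_out:
  assumes "p \<in> points D"
  shows "arc_out D p \<in> arcs D" "\<forall>\<^sub>F t in at_right 0. (fst p, snd p * cis t) \<in> arc_out D p"
  using theI'[OF ex1_arc[OF assms, of "at_right 0"]] by (auto simp: arc_out_def)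

lemma fst_arc_in:
  assumes "p \<in> points D"
  shows "fst ` arc_in D p = {fst p}"
proof -
  obtain t where t: "(fst p, snd p * cis t) \<in> arc_in D p"
    using eventually_happens'[OF _ arc_in(2)[OF assms]] by auto
  show ?thesis using fst_image_arc[OF arc_in(1)[OF assms] t] by simp
qed

lemma fst_arc_out:
  assumes "p \<in> points D"
  shows "fst ` arc_out D p = {fst p}"
proof -
  obtain t where t: "(fst p, snd p * cis t) \<in> arc_out D p"
    using eventually_happens'[OF _ arc_out(2)[OF assms]] by auto
  show ?thesis using fst_image_arc[OF arc_out(1)[OF assms] t] by simp
qed

lemma arcs_nonempty: "arcs D \<noteq> {}"
proof -
  have "(0, 1) \<in> points D" using diagram by (auto simp: points_def vlink_diagram_def)
  then show ?thesis using arc_in(1) by blast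
qed

lemma fibre_points: "p \<in> fibre D z \<Longrightarrow> p \<in> points D"
  by (simp add: fibre_def)

section \<open>Flipping the colours of components\<close>

text \<open>The image of an arc under \<open>fst\<close> is the singleton of its component index, so
  the test asks whether that component lies in \<open>I\<close>. Taking \<open>I = UNIV\<close>
  gives the dual.\<close>

definition flip :: "nat set \<Rightarrow> colouring \<Rightarrow> colouring" where
  "flip I C = restrict (\<lambda>a. if fst ` a \<subseteq> I then opposite (C a) else C a) (arcs D)"

lemma opposite_eq_iff [simp]:
  "opposite c = opposite d \<longleftrightarrow> c = d" "opposite c = d \<longleftrightarrow> c \<noteq> d" "d = opposite c \<longleftrightarrow> c \<noteq> d"
  by (cases c; cases d; simp)+

lemma dual_eq_flip: "dual D C = flip UNIV C"
  by (simp add: dual_def flip_def)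

lemma flip_arc_in:
  assumes "p \<in> points D"
  shows "flip I C (arc_in D p) = (if fst p \<in> I then opposite (C (arc_in D p)) else C (arc_in D p))"
  using arc_in(1)[OF assms] fst_arc_in[OF assms] by (simp add: flip_def)

lemma flip_arc_out:
  assumes "p \<in> points D"
  shows "flip I C (arc_out D p) = (if fst p \<in> I then opposite (C (arc_out D p)) else C (arc_out D p))"
  using arc_out(1)[OF assms] fst_arc_out[OF assms] by (simp add: flip_def)

text \<open>The arcs into and out of a point lie on the same component, so a flip reverses both or
  neither.\<close>

lemma flip_two_colourings:
  assumes "C \<in> two_colourings D"
  shows "flip I C \<in> two_colourings D"
proof -
  have "flip I C (arc_in D p) \<noteq> flip I C (arc_out D p)" if "z \<in> classical D" "p \<in> fibre D z" for z p
    using assms that by (auto simp: two_colourings_def flip_arc_in flip_arc_out fibre_points)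
  moreover have "flip I C \<in> arcs D \<rightarrow>\<^sub>E UNIV" by (simp add: flip_def)
  ultimately show ?thesis by (simp add: two_colourings_def)
qed

text \<open>Parity compares the two incoming colours, and the comparison changes iff exactly one of
  them is reversed.\<close>

lemma parity_flip:
  assumes "z \<in> classical D"
  shows "parity D (flip I C) z = 1 \<longleftrightarrow>
    (parity D C z = 1 \<longleftrightarrow> (fst (over D z) \<in> I \<longleftrightarrow> fst (under D z) \<in> I))"
  using fibre_points[OF over_in_fibre[OF assms]] fibre_points[of "under D z" z]
    under_in_fibre[OF assms]
  by (auto simp: parity_def flip_arc_in)

section \<open>Generating sets and the entries of the 2-colour writhe\<close>

lemma J_dual: "J D (dual D C) = J D C"
proof -
  have "{z \<in> classical D. parity D (dual D C) z = 1} = {z \<in> classical D. parity D C z = 1}"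
    by (auto simp: dual_eq_flip parity_flip simp del: One_nat_def)
  then show ?thesis by (simp add: J_def)
qed

lemma finite_two_colourings: "finite (two_colourings D)"
proof (rule finite_subset)
  have "(UNIV :: colour set) = {Red, Green}"
    by (auto intro: colour.exhaust)
  then have "finite (UNIV :: colour set)" by (metis finite.emptyI finite_insert)
  then show "finite (arcs D \<rightarrow>\<^sub>E (UNIV :: colour set))" 
    using finite_PiE[OF finite_arcs, of "\<lambda>_. UNIV"] by blast
  show "two_colourings D \<subseteq> arcs D \<rightarrow>\<^sub>E UNIV"
    unfolding two_colourings_def by (rule Collect_restrict)
qed

text \<open>Fix an arc \<open>a\<close>. Dual colourings differ on \<open>a\<close>, so the
  colourings that are red there contain exactly one of each dual pair.\<close>

lemma ex_generating_set: "\<exists>G. generating_set D G"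
proof -
  obtain a where a: "a \<in> arcs D" using arcs_nonempty by blast
  have "card ({C \<in> two_colourings D. C a = Red} \<inter> {C, dual D C}) = 1"
    if "C \<in> two_colourings D" for C
  proof (cases "C a = Red")
    case True
    then have "{C \<in> two_colourings D. C a = Red} \<inter> {C, dual D C} = {C}"
      using that a by (auto simp: dual_def)
    then show ?thesis by simp
  next
    case False
    then have "{C \<in> two_colourings D. C a = Red} \<inter> {C, dual D C} = {dual D C}"
      using that a flip_two_colourings[OF that, of UNIV] by (auto simp: dual_def flip_def)
    then show ?thesis by simp
  qed
  then show ?thesis by (intro exI[of _ "{C \<in> two_colourings D. C a = Red}"])
      (auto simp: generating_set_def)
qed

text \<open>Whatever generating set is chosen in \<open>J2\<close>, it contains \<open>C\<close> or
  its dual, and \<open>J\<close> agrees on these. Triviality of \<open>J2\<close> thus makes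
  \<open>J\<close> vanish on every colouring.\<close>

lemma J_mem_J2:
  assumes "C \<in> two_colourings D"
  shows "J D C \<in># J2 D"
proof -
  define G where "G = (SOME G. generating_set D G)"
  have G: "generating_set D G" unfolding G_def using ex_generating_set by (rule someI_ex)
  \<comment> \<open>Finiteness matters because \<open>mset_set\<close> of an infinite set is
    empty.\<close>
  then have "finite G"
    using finite_two_colourings finite_subset unfolding generating_set_def by blast
  moreover have "G \<inter> {C, dual D C} \<noteq> {}"
    using G assms unfolding generating_set_def by (metis card.empty zero_neq_one)
  then have "C \<in> G \<or> dual D C \<in> G" by blast
  then have "J D C \<in> J D ` G" using J_dual imageI by metis
  ultimately show ?thesis by (simp add: J2_def G_def)
qed

text \<open>The self-crossing part does not depend on \<open>I\<close>, since a flip preserves the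
  parity of a self-crossing.\<close>

lemma J_flip_split:
  "J D (flip I C) = (\<Sum>z | z \<in> self_crossings D \<and> parity D C z = 1. crossing_sign D z) +
    (\<Sum>z | z \<in> mixed_crossings D \<and> parity D (flip I C) z = 1. crossing_sign D z)"
proof -
  have "{z \<in> classical D. parity D (flip I C) z = 1} =
      {z \<in> self_crossings D. parity D C z = 1} \<union>
      {z \<in> mixed_crossings D. parity D (flip I C) z = 1}"
    by (auto simp: self_crossings_def mixed_crossings_def parity_flip simp del: One_nat_def)
  then show ?thesis unfolding J_def
    by (simp only:) (intro sum.union_disjoint,
        auto simp: self_crossings_def mixed_crossings_def finite_classical)
qed

text \<open>Toggling the component of the over-strand in \<open>I\<close> is an involution. It
  leaves the membership of the other component unchanged, so it exchanges the odd and the even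
  flips.\<close>

lemma card_flips_odd:
  assumes "z \<in> mixed_crossings D"
  shows "2 * card {I \<in> Pow {..<ncomp D}. parity D (flip I C) z = 1} = 2 ^ ncomp D"
proof -
  let ?P = "Pow {..<ncomp D}"
  let ?odd = "\<lambda>I. parity D (flip I C) z = 1"
  have z: "z \<in> classical D" and ne: "fst (over D z) \<noteq> fst (under D z)"
    using assms by (auto simp: mixed_crossings_def)
  define i where "i = fst (over D z)"
  define t where "t I = sym_diff I {i}" for I
  have i: "i < ncomp D" using over_in_fibre[OF z] by (auto simp: i_def fibre_def points_def)
  have t: "t (t I) = I" "I \<in> ?P \<Longrightarrow> t I \<in> ?P" "?odd (t I) \<longleftrightarrow> \<not> ?odd I" for I
    using i ne unfolding parity_flip[OF z] by (auto simp: t_def i_def)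
  have "bij_betw t {I \<in> ?P. ?odd I} {I \<in> ?P. \<not> ?odd I}"
    using t by (intro bij_betw_byWitness[where f' = t]) auto
  then have "card {I \<in> ?P. ?odd I} = card {I \<in> ?P. \<not> ?odd I}" by (rule bij_betw_same_card)
  moreover have "card ?P = card {I \<in> ?P. ?odd I} + card {I \<in> ?P. \<not> ?odd I}"
    by (subst card_Un_disjoint[symmetric]) (auto intro!: arg_cong[where f = card])
  ultimately show ?thesis by (simp add: card_Pow)
qed

text \<open>Signs are summed over all pairs of a mixed crossing and a flip making it odd. For each
  fixed flip the sum is zero by \<open>J_flip_split\<close>; for each fixed crossing the sign occurs
  for half of the flips. The extra factor 2 keeps the computation in the integers.\<close>

lemma naive_writhe_zero:
  assumes "two_colourable D" "trivial_pair (J2 D, J2S D)"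
  shows "naive_writhe D = 0"
proof -
  let ?P = "Pow {..<ncomp D}"
  \<comment> \<open>The same choice as in \<open>J2S\<close>, so that the sum in \<open>S\<close> is
    literally \<open>J2S D\<close>.\<close>
  define C where "C = (SOME C. C \<in> two_colourings D)"
  have C: "C \<in> two_colourings D"
    using assms(1) unfolding C_def two_colourable_def by (simp add: some_in_eq)
  have S: "(\<Sum>z | z \<in> self_crossings D \<and> parity D C z = 1. crossing_sign D z) = 0"
    using assms(2) unfolding trivial_pair_def J2S_def Let_def snd_conv C_def[symmetric]
    by (rule conjunct2)
  have fin: "finite (mixed_crossings D)"
    using finite_classical by (simp add: mixed_crossings_def)
  have zero: "(\<Sum>z | z \<in> mixed_crossings D \<and> parity D (flip I C) z = 1. crossing_sign D z) = 0"
    for I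
  proof -
    have "J D (flip I C) = 0"
      using assms(2) J_mem_J2[OF flip_two_colourings[OF C]] unfolding trivial_pair_def fst_conv
      by blast
    then show ?thesis unfolding J_flip_split S by simp
  qed
  define k where "k z = card {I \<in> ?P. parity D (flip I C) z = 1}" for z
  have half: "2 ^ ncomp D * crossing_sign D z = 2 * (int (k z) * crossing_sign D z)"
    if "z \<in> mixed_crossings D" for z
  proof -
    have "int (2 * k z) = int (2 ^ ncomp D)"
      unfolding k_def card_flips_odd[OF that] ..
    then show ?thesis by simp
  qed
  have "2 ^ ncomp D * naive_writhe D = (\<Sum>z\<in>mixed_crossings D. 2 ^ ncomp D * crossing_sign D z)"
    unfolding naive_writhe_def by (rule sum_distrib_left)
  also have "\<dots> = (\<Sum>z\<in>mixed_crossings D. 2 * (int (k z) * crossing_sign D z))"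
    by (rule sum.cong[OF refl half])
  also have "\<dots> = 2 * (\<Sum>z\<in>mixed_crossings D. \<Sum>I\<in>?P.
      if parity D (flip I C) z = 1 then crossing_sign D z else 0)"
    unfolding sum_distrib_left[symmetric] k_def by (simp add: sum.inter_filter[symmetric])
  also have "\<dots> = 2 * (\<Sum>I\<in>?P. \<Sum>z\<in>mixed_crossings D.
      if parity D (flip I C) z = 1 then crossing_sign D z else 0)"
    \<comment> \<open>The order of summation is exchanged: flips outside, crossings inside.\<close>
    by (subst sum.swap) simp
  also have "\<dots> = 2 * (\<Sum>I\<in>?P. 0)"
    unfolding sum.inter_filter[OF fin, symmetric] zero ..
  finally show ?thesis by simp
qed

section \<open>Colourings from sign functions\<close>

text \<open>Meant for continuous \<open>h\<close> whose zeros are marked points. Then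
  \<open>h\<close> has constant sign on each arc, and the existential reads off that sign without
  choosing a point.\<close>

definition sign_colouring :: "(nat \<Rightarrow> complex \<Rightarrow> real) \<Rightarrow> colouring" where
  "sign_colouring h =
    restrict (\<lambda>a. if \<exists>p\<in>a. h (fst p) (snd p) > 0 then Red else Green) (arcs D)"

text \<open>By the intermediate value theorem, a change of sign on the connected arc would force a
  zero there.\<close>

lemma sign_colouring_arc:
  assumes "\<And>i. i < ncomp D \<Longrightarrow> continuous_on circle (h i)"
    and "\<And>i w. i < ncomp D \<Longrightarrow> w \<in> circle - marked D i \<Longrightarrow> h i w \<noteq> 0"
    and "a \<in> arcs D" "p \<in> a"
  shows "sign_colouring h a = Red \<longleftrightarrow> h (fst p) (snd p) > 0"
proof -
  obtain i A where A: "i < ncomp D" "a = {i} \<times> A" "connected A" "A \<subseteq> circle - marked D i"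
    using arc_connected[OF assms(3)] by metis
  have conn: "connected (h i ` A)"
    using A assms(1) by (intro connected_continuous_image) (auto intro: continuous_on_subset)
  have nz: "0 \<notin> h i ` A" using A assms(2)[OF A(1)] by fastforce
  have pos: "h i v > 0" if "v \<in> A" "w \<in> A" "h i w > 0" for v w
  proof (rule ccontr)
    assume "\<not> h i v > 0"
    then have "0 \<in> h i ` A"
      using connectedD_interval[OF conn, of "h i v" "h i w" 0] that by auto
    then show False using nz by blast
  qed
  obtain v where v: "p = (i, v)" "v \<in> A" using A(2) assms(4) by blast
  have "(\<exists>q\<in>a. h (fst q) (snd q) > 0) \<longleftrightarrow> h i v > 0"
    unfolding A(2) using pos[OF v(2)] v(2) by auto
  then show ?thesis using assms(3) v(1) by (simp add: sign_colouring_def)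
qed

text \<open>At a simple zero with slope \<open>d\<close>, the function has the sign of
  \<open>-d\<close> just before and of \<open>d\<close> just after. The colour therefore changes,
  and the slope determines the incoming colour.\<close>

lemma sign_colouring_crossing:
  assumes "\<And>i. i < ncomp D \<Longrightarrow> continuous_on circle (h i)"
    and "\<And>i w. i < ncomp D \<Longrightarrow> w \<in> circle - marked D i \<Longrightarrow> h i w \<noteq> 0"
    and "p \<in> points D" "h (fst p) (snd p) = 0"
    and "((\<lambda>t. h (fst p) (snd p * cis t)) has_real_derivative d) (at 0)" "d \<noteq> 0"
  shows "sign_colouring h (arc_in D p) = Red \<longleftrightarrow> d < 0"
    and "sign_colouring h (arc_out D p) = Red \<longleftrightarrow> d > 0"
proof -
  let ?f = "\<lambda>t. h (fst p) (snd p * cis t)"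
  have lim: "((\<lambda>t. ?f t / t) \<longlongrightarrow> d) (at 0)"
    using assms(4,5) by (simp add: has_field_derivative_iff)
  have ev: "\<forall>\<^sub>F t in at 0. ?f t / t > 0 \<longleftrightarrow> d > 0"
  proof (cases "d > 0")
    case True
    then show ?thesis using order_tendstoD(1)[OF lim, of 0] by (simp add: eventually_mono)
  next
    case False
    then have "\<forall>\<^sub>F t in at 0. ?f t / t < 0"
      using order_tendstoD(2)[OF lim, of 0] assms(6) by simp
    then show ?thesis by (rule eventually_mono) (use False in auto)
  qed
  have E: "\<forall>\<^sub>F t in at_left 0. (?f t / t > 0 \<longleftrightarrow> d > 0) \<and> (fst p, snd p * cis t) \<in> arc_in D p \<and> t < 0"
    using ev by (intro eventually_conj arc_in(2)[OF assms(3)])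
      (auto simp: eventually_at_split intro: eventually_at_leftI[of "-1"])
  obtain t where t: "?f t / t > 0 \<longleftrightarrow> d > 0" "(fst p, snd p * cis t) \<in> arc_in D p" "t < 0"
    using eventually_happens'[OF trivial_limit_at_left_real E] by blast
  \<comment> \<open>For \<open>d < 0\<close> the quotient is only known not to be positive;
    excluding zero makes \<open>?f t\<close> strictly positive.\<close>
  have "?f t \<noteq> 0"
    using arc_connected[OF arc_in(1)[OF assms(3)]] t(2) assms(2)
    by (metis SigmaD1 SigmaD2 singletonD subsetD)
  then have "?f t > 0 \<longleftrightarrow> d < 0" using t(1,3) assms(6) by (auto simp: zero_less_divide_iff)
  then show "sign_colouring h (arc_in D p) = Red \<longleftrightarrow> d < 0"
    using sign_colouring_arc[OF assms(1,2) arc_in(1)[OF assms(3)] t(2)] by simp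
  have E: "\<forall>\<^sub>F t in at_right 0. (?f t / t > 0 \<longleftrightarrow> d > 0) \<and> (fst p, snd p * cis t) \<in> arc_out D p \<and> t > 0"
    using ev by (intro eventually_conj arc_out(2)[OF assms(3)])
      (auto simp: eventually_at_split intro: eventually_at_rightI[of _ 1])
  obtain t where t: "?f t / t > 0 \<longleftrightarrow> d > 0" "(fst p, snd p * cis t) \<in> arc_out D p" "t > 0"
    using eventually_happens'[OF trivial_limit_at_right_real E] by blast
  then have "?f t > 0 \<longleftrightarrow> d > 0" by (auto simp: zero_less_divide_iff)
  then show "sign_colouring h (arc_out D p) = Red \<longleftrightarrow> d > 0"
    using sign_colouring_arc[OF assms(1,2) arc_out(1)[OF assms(3)] t(2)] by simp
qed

end

section \<open>A chain of three circles\<close>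

text \<open>The unit circles with centres \<open>0\<close>, \<open>6/5\<close> and \<open>12/5\<close>: consecutive circles meet in points with
  coordinates in \<open>\<rat>\<close>, by the Pythagorean triple \<open>(3, 4, 5)\<close>.\<close>

definition chain :: vdiagram where
  "chain = \<lparr>ncomp = 3, curve = (\<lambda>i w. of_real (6 / 5 * real i) + w),
    classical = {Complex (3/5) (4/5), Complex (3/5) (- (4/5)), Complex (9/5) (4/5), Complex (9/5) (- (4/5))},
    over = (\<lambda>z. if z = Complex (3/5) (4/5) then (0, Complex (3/5) (4/5))
      else if z = Complex (9/5) (4/5) then (2, Complex (- (3/5)) (4/5))
      else (1, Complex (Re z - 6/5) (Im z)))\<rparr>"

lemma norm_eq_1_iff: "norm z = 1 \<longleftrightarrow> (Re z)\<^sup>2 + (Im z)\<^sup>2 = 1"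
  by (simp add: cmod_def)

lemma classical_chain:
  "classical chain =
    {Complex (3/5) (4/5), Complex (3/5) (- (4/5)), Complex (9/5) (4/5), Complex (9/5) (- (4/5))}"
  by (simp add: chain_def)

lemma over_chain:
  "over chain (Complex (3/5) (4/5)) = (0, Complex (3/5) (4/5))"
  "over chain (Complex (3/5) (- (4/5))) = (1, Complex (- (3/5)) (- (4/5)))"
  "over chain (Complex (9/5) (4/5)) = (2, Complex (- (3/5)) (4/5))"
  "over chain (Complex (9/5) (- (4/5))) = (1, Complex (3/5) (- (4/5)))"
  by (simp_all add: chain_def)

text \<open>Each circle is embedded, so a fibre point is determined by its index. Solving for
  \<open>w\<close> leaves one quadratic equation.\<close>

lemma mem_fibre_chain:
  "(i, w) \<in> fibre chain z \<longleftrightarrow>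
    i < 3 \<and> w = Complex (Re z - 6/5 * real i) (Im z) \<and> (Re z - 6/5 * real i)\<^sup>2 + (Im z)\<^sup>2 = 1"
proof -
  have "of_real (6 / 5 * real i) + w = z \<longleftrightarrow> w = Complex (Re z - 6/5 * real i) (Im z)"
    by (auto simp: complex_eq_iff)
  then show ?thesis
    by (auto simp: fibre_def points_def pos_def chain_def norm_eq_1_iff)
qed

lemma less_3_cases: "i < (3::nat) \<longleftrightarrow> i = 0 \<or> i = 1 \<or> i = 2"
  by auto

lemma fibre_chain:
  "fibre chain (Complex (3/5) (4/5)) = {(0, Complex (3/5) (4/5)), (1, Complex (- (3/5)) (4/5))}"
  "fibre chain (Complex (3/5) (- (4/5))) = {(0, Complex (3/5) (- (4/5))), (1, Complex (- (3/5)) (- (4/5)))}"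
  "fibre chain (Complex (9/5) (4/5)) = {(1, Complex (3/5) (4/5)), (2, Complex (- (3/5)) (4/5))}"
  "fibre chain (Complex (9/5) (- (4/5))) = {(1, Complex (3/5) (- (4/5))), (2, Complex (- (3/5)) (- (4/5)))}"
  by (auto simp: mem_fibre_chain less_3_cases power2_eq_square)

lemma card_fibre_chain: "z \<in> classical chain \<Longrightarrow> card (fibre chain z) = 2"
  by (auto simp: classical_chain fibre_chain)

text \<open>Subtracting the equations of two different circles eliminates \<open>Im z\<close> and
  fixes \<open>Re z\<close>. For the outer two circles this would give \<open>Re z = 6/5\<close> and
  a negative square of \<open>Im z\<close>, so they do not meet.\<close>

lemma crossings_chain: "crossings chain = classical chain"
proof
  show "crossings chain \<subseteq> classical chain"
  proof
    fix z assume "z \<in> crossings chain"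
    then obtain i v j w where "(i, v) \<in> fibre chain z" "(j, w) \<in> fibre chain z" "(i, v) \<noteq> (j, w)"
      unfolding crossings_def by fast
    then have ij: "i < 3" "j < 3" "i \<noteq> j"
      and sq: "(Re z - 6/5 * real i)\<^sup>2 + (Im z)\<^sup>2 = 1" "(Re z - 6/5 * real j)\<^sup>2 + (Im z)\<^sup>2 = 1"
      by (auto simp: mem_fibre_chain)
    have Im: "Im z = 4/5 \<or> Im z = - (4/5)" if "(Im z)\<^sup>2 = 16/25"
    proof -
      have "(Im z)\<^sup>2 = (4/5)\<^sup>2" using that by (simp add: power2_eq_square)
      then show ?thesis unfolding power2_eq_iff by simp
    qed
    have "(Re z = 3/5 \<or> Re z = 9/5) \<and> (Im z)\<^sup>2 = 16/25"
    proof -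
      have "Re z = 3/5 \<and> (Im z)\<^sup>2 = 16/25"
        if "(Re z)\<^sup>2 + (Im z)\<^sup>2 = 1" "(Re z - 6/5)\<^sup>2 + (Im z)\<^sup>2 = 1"
      proof -
        have x: "Re z = 3/5" using that by (simp add: power2_eq_square algebra_simps)
        then show ?thesis using that(1) unfolding x by (simp add: power2_eq_square)
      qed
      moreover have "Re z = 9/5 \<and> (Im z)\<^sup>2 = 16/25"
        if "(Re z - 6/5)\<^sup>2 + (Im z)\<^sup>2 = 1" "(Re z - 12/5)\<^sup>2 + (Im z)\<^sup>2 = 1"
      proof -
        have x: "Re z = 9/5" using that by (simp add: power2_eq_square algebra_simps)
        then show ?thesis using that(1) unfolding x by (simp add: power2_eq_square)
      qed
      moreover have False
        if "(Re z)\<^sup>2 + (Im z)\<^sup>2 = 1" "(Re z - 12/5)\<^sup>2 + (Im z)\<^sup>2 = 1"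
      proof -
        have x: "Re z = 6/5" using that by (simp add: power2_eq_square algebra_simps)
        have "(Im z)\<^sup>2 = 1 - (6/5)\<^sup>2" using that(1) unfolding x by linarith
        then have "(Im z)\<^sup>2 < 0" by (simp add: power2_eq_square)
        then show False by simp
      qed
      ultimately show ?thesis
        using ij sq unfolding less_3_cases by (elim disjE) simp_all
    qed
    then show "z \<in> classical chain"
      using Im by (auto simp: chain_def complex_eq_iff)
  qed
  show "classical chain \<subseteq> crossings chain"
  proof
    fix z assume "z \<in> classical chain"
    then obtain p q where "fibre chain z = {p, q}" "p \<noteq> q"
      using card_fibre_chain by (meson card_2_iff)
    then show "z \<in> crossings chain" unfolding crossings_def by blast
  qed
qed

section \<open>Tangents, crossing signs and naive writhe of the chain\<close>

lemma has_vector_derivative_cis: "((\<lambda>t. c * cis t) has_vector_derivative \<i> * c * cis t) (at t within S)"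
  unfolding cis_conv_exp
  by (rule has_vector_derivative_real_field[of "\<lambda>z. c * exp (\<i> * z)"])
    (auto intro!: derivative_eq_intros)

lemma tangent_chain: "tangent chain p = \<i> * snd p"
proof -
  have "((\<lambda>t. of_real (6 / 5 * real (fst p)) + snd p * cis t) has_vector_derivative
      0 + \<i> * snd p * cis 0) (at 0)"
    by (intro has_vector_derivative_add has_vector_derivative_const has_vector_derivative_cis)
  then show ?thesis
    by (simp add: tangent_def chain_def vector_derivative_at)
qed

lemma smooth_chain: "smooth (\<lambda>t. curve chain i (cis t))"
proof -
  \<comment> \<open>Each derivative contributes a factor \<open>\<i>\<close>; the constant centre
    survives only in order 0.\<close>
  define g where "g k t = (if k = 0 then of_real (6 / 5 * real i) else 0) + \<i> ^ k * cis t" for k t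
  have "(g k has_vector_derivative 0 + \<i> * \<i> ^ k * cis t) (at t)" for k t
    unfolding g_def
    by (intro has_vector_derivative_add has_vector_derivative_const has_vector_derivative_cis)
  moreover have "g 0 = (\<lambda>t. curve chain i (cis t))" by (simp add: g_def chain_def fun_eq_iff)
  ultimately show ?thesis unfolding smooth_def by (intro exI[of _ g]) (simp add: g_def)
qed

lemma vlink_diagram_chain: "vlink_diagram chain"
  unfolding vlink_diagram_def crossings_chain
proof (intro conjI)
  show "\<forall>p\<in>points chain. tangent chain p \<noteq> 0"
    by (auto simp: tangent_chain points_def)
  show "\<forall>z\<in>classical chain. card (fibre chain z) = 2"
    by (simp add: card_fibre_chain)
  show "\<forall>z\<in>classical chain. \<forall>p\<in>fibre chain z. \<forall>q\<in>fibre chain z.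
      p \<noteq> q \<longrightarrow> cross (tangent chain p) (tangent chain q) \<noteq> 0"
    by (simp add: classical_chain fibre_chain tangent_chain cross_def)
  show "\<forall>z\<in>classical chain. over chain z \<in> fibre chain z"
    by (simp add: classical_chain fibre_chain over_chain)
qed (auto simp: smooth_chain classical_chain, simp add: chain_def)

interpretation chain: diagram chain
  by unfold_locales (rule vlink_diagram_chain)

lemma under_chain:
  "under chain (Complex (3/5) (4/5)) = (1, Complex (- (3/5)) (4/5))"
  "under chain (Complex (3/5) (- (4/5))) = (0, Complex (3/5) (- (4/5)))"
  "under chain (Complex (9/5) (4/5)) = (1, Complex (3/5) (4/5))"
  "under chain (Complex (9/5) (- (4/5))) = (2, Complex (- (3/5)) (- (4/5)))"
  using chain.under_in_fibre unfolding classical_chain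
  by (force simp: fibre_chain over_chain)+

text \<open>The middle circle is over at both lower crossings and under at both upper ones.
  Reflection in the real axis swaps over and under within each pair and so preserves signs.
  Reflection in the vertical line through \<open>6/5\<close> keeps the over-strands and exchanges
  the pairs, hence the opposite signs.\<close>

lemma crossing_sign_chain:
  "crossing_sign chain (Complex (3/5) (4/5)) = 1"
  "crossing_sign chain (Complex (3/5) (- (4/5))) = 1"
  "crossing_sign chain (Complex (9/5) (4/5)) = -1"
  "crossing_sign chain (Complex (9/5) (- (4/5))) = -1"
  by (simp_all add: crossing_sign_def over_chain under_chain tangent_chain cross_def)

lemma naive_writhe_chain: "naive_writhe chain = 0"
proof -
  have "mixed_crossings chain = classical chain"
    by (auto simp: mixed_crossings_def classical_chain over_chain under_chain)
  then show ?thesis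
    by (simp add: naive_writhe_def classical_chain crossing_sign_chain)
qed

text \<open>On each circle this vanishes exactly at the marked points. The middle circle has four of
  them, with real parts \<open>3/5\<close> and \<open>-3/5\<close>, hence the quadratic expression,
  whose sign alternates along its four arcs.\<close>

definition chain_sign :: "nat \<Rightarrow> complex \<Rightarrow> real" where
  "chain_sign i w =
    (if i = 0 then Re w - 3/5 else if i = 1 then Re w * Re w - 9/25 else Re w + 3/5)"

text \<open>The derivative of \<open>chain_sign\<close> along the counterclockwise circle, where the
  real part changes at rate \<open>- Im\<close>.\<close>

definition chain_slope :: "point \<Rightarrow> real" where
  "chain_slope p = (if fst p = 1 then - 2 * Re (snd p) * Im (snd p) else - Im (snd p))"

definition chain_colouring :: colouring where
  "chain_colouring = chain.sign_colouring chain_sign"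

lemma continuous_on_chain_sign: "continuous_on S (chain_sign i)"
proof -
  consider "i = 0" | "i = 1" | "i > 1" by linarith
  then show ?thesis by cases (auto simp: chain_sign_def[abs_def] intro!: continuous_intros)
qed

text \<open>A zero fixes the square of the real part, and the circle equation then gives imaginary
  part \<open>4/5\<close> or \<open>-4/5\<close>. Shifted by the centre, such a point is a crossing
  and was removed.\<close>

lemma chain_sign_nonzero:
  assumes "i < ncomp chain" "w \<in> circle - marked chain i"
  shows "chain_sign i w \<noteq> 0"
proof
  assume zero: "chain_sign i w = 0"
  have w: "Re w * Re w + Im w * Im w = 1"
    using assms(2) by (simp add: norm_eq_1_iff power2_eq_square)
  have i: "i = 0 \<or> i = 1 \<or> i = 2" using assms(1) by (auto simp: chain_def)
  have Re: "i = 0 \<Longrightarrow> Re w = 3/5" "i = 2 \<Longrightarrow> Re w = - (3/5)" "i = 1 \<Longrightarrow> Re w * Re w = 9/25"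
    using zero by (simp_all add: chain_sign_def)
  have sq: "(Re w)\<^sup>2 = (3/5)\<^sup>2"
    using i
  proof (elim disjE)
    assume "i = 0" show ?thesis unfolding Re(1)[OF \<open>i = 0\<close>] ..
  next
    assume "i = 1" show ?thesis unfolding power2_eq_square Re(3)[OF \<open>i = 1\<close>] by simp
  next
    assume "i = 2" show ?thesis unfolding Re(2)[OF \<open>i = 2\<close>] by simp
  qed
  have "(Im w)\<^sup>2 = (4/5)\<^sup>2"
    using w sq by (simp add: power2_eq_square)
  with sq have "(Re w = 3/5 \<or> Re w = - (3/5)) \<and> (Im w = 4/5 \<or> Im w = - (4/5))"
    unfolding power2_eq_iff by simp
  then have "of_real (6 / 5 * real i) + w \<in> classical chain"
    \<comment> \<open>On the middle circle all four sign choices are crossings; on the outer circles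
      the sign of the real part is prescribed.\<close>
    using i Re(1,2) unfolding classical_chain by (auto simp: complex_eq_iff)
  then show False using assms(2) by (simp add: marked_def chain_def)
qed

lemma chain_sign_derivative:
  "((\<lambda>t. chain_sign (fst p) (snd p * cis t)) has_real_derivative chain_slope p) (at 0)"
proof -
  consider "fst p = 0" | "fst p = 1" | "fst p > 1" by linarith
  then show ?thesis
    by cases (auto simp: chain_sign_def chain_slope_def intro!: derivative_eq_intros)
qed

lemma chain_sign_slope_at_crossing:
  assumes "z \<in> classical chain" "p \<in> fibre chain z"
  shows "chain_sign (fst p) (snd p) = 0 \<and> chain_slope p \<noteq> 0"
  using assms by (auto simp: classical_chain fibre_chain chain_sign_def chain_slope_def)

lemma chain_colouring_arc:
  assumes "z \<in> classical chain" "p \<in> fibre chain z"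
  shows "chain_colouring (arc_in chain p) = Red \<longleftrightarrow> chain_slope p < 0"
    and "chain_colouring (arc_out chain p) = Red \<longleftrightarrow> chain_slope p > 0"
proof -
  note slope = chain_sign_slope_at_crossing[OF assms]
  note red = chain.sign_colouring_crossing[where h = chain_sign and p = p and d = "chain_slope p",
      OF continuous_on_chain_sign chain_sign_nonzero chain.fibre_points[OF assms(2)]
        conjunct1[OF slope] chain_sign_derivative conjunct2[OF slope],
      folded chain_colouring_def]
  show "chain_colouring (arc_in chain p) = Red \<longleftrightarrow> chain_slope p < 0" by (rule red(1))
  show "chain_colouring (arc_out chain p) = Red \<longleftrightarrow> chain_slope p > 0" by (rule red(2))
qed

lemma chain_colouring: "chain_colouring \<in> two_colourings chain"
proof -
  have "chain_colouring (arc_in chain p) \<noteq> chain_colouring (arc_out chain p)"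
    if "z \<in> classical chain" "p \<in> fibre chain z" for z p
    using chain_colouring_arc[OF that] chain_sign_slope_at_crossing[OF that] by force
  moreover have "chain_colouring \<in> arcs chain \<rightarrow>\<^sub>E UNIV"
    by (simp add: chain_colouring_def chain.sign_colouring_def)
  ultimately show ?thesis by (simp add: two_colourings_def)
qed

lemma J_chain: "J chain chain_colouring = -2"
proof -
  have "parity chain chain_colouring z = 1 \<longleftrightarrow>
      (chain_slope (over chain z) < 0 \<longleftrightarrow> chain_slope (under chain z) < 0)"
    if z: "z \<in> classical chain" for z
  proof -
    have under: "under chain z \<in> fibre chain z" using chain.under_in_fibre[OF z] by (rule conjunct1)
    have "chain_colouring (arc_in chain (over chain z)) = chain_colouring (arc_in chain (under chain z))
        \<longleftrightarrow> (chain_slope (over chain z) < 0 \<longleftrightarrow> chain_slope (under chain z) < 0)"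
      unfolding chain_colouring_arc(1)[OF z chain.over_in_fibre[OF z], symmetric]
        chain_colouring_arc(1)[OF z under, symmetric]
      by (metis colour.exhaust)
    then show ?thesis by (simp add: parity_def)
  qed
  then have "{z \<in> classical chain. parity chain chain_colouring z = 1} =
      {z \<in> classical chain. chain_slope (over chain z) < 0 \<longleftrightarrow> chain_slope (under chain z) < 0}"
    by blast
  \<comment> \<open>On the outer circles the slope has the sign of \<open>- Im\<close>. On the
    middle circle the same holds only where the real part is positive, which is at its crossings
    with the last circle; there the slopes agree.\<close>
  also have "\<dots> = {Complex (9/5) (4/5), Complex (9/5) (- (4/5))}"
    by (auto simp: classical_chain over_chain under_chain chain_slope_def)
  finally show ?thesis by (simp add: J_def crossing_sign_chain)
qed

theorem theorem5p3:
  shows "(\<forall>L\<in>virtual_links. \<forall>D\<in>L.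
            two_colourable D \<longrightarrow> trivial_pair (J2 D, J2S D) \<longrightarrow> naive_writhe D = 0) \<and>
         (\<exists>L\<in>virtual_links. \<exists>D\<in>L.
            two_colourable D \<and> \<not> trivial_pair (J2 D, J2S D) \<and> naive_writhe D = 0)"
proof (intro conjI ballI impI)
  fix L D assume L: "L \<in> virtual_links" and D: "D \<in> L"
    and "two_colourable D" "trivial_pair (J2 D, J2S D)"
  have "vlink_diagram D"
    using L D unfolding virtual_links_def by (auto elim!: quotientE)
  then interpret diagram D by unfold_locales
  show "naive_writhe D = 0" by (rule naive_writhe_zero) fact+
next
  let ?R = "{(D, D'). vlink_diagram D \<and> vlink_diagram D' \<and> equivclp vmove D D'}"
  have "?R `` {chain} \<in> virtual_links"
    unfolding virtual_links_def by (rule quotientI) (simp add: vlink_diagram_chain)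
  moreover have "chain \<in> ?R `` {chain}" by (simp add: vlink_diagram_chain)
  moreover have "two_colourable chain"
    using chain_colouring by (auto simp: two_colourable_def)
  \<comment> \<open>The entry -2 of \<open>J2 chain\<close> prevents triviality.\<close>
  moreover have "\<not> trivial_pair (J2 chain, J2S chain)"
  proof
    assume "trivial_pair (J2 chain, J2S chain)"
    then have "J chain chain_colouring = 0"
      using chain.J_mem_J2[OF chain_colouring] unfolding trivial_pair_def fst_conv by blast
    then show False using J_chain by simp
  qed
  ultimately show "\<exists>L\<in>virtual_links. \<exists>D\<in>L.
      two_colourable D \<and> \<not> trivial_pair (J2 D, J2S D) \<and> naive_writhe D = 0"
    by (intro bexI[of _ "?R `` {chain}"] bexI[of _ chain] conjI naive_writhe_chain)
qed

end
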